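(* Let $K$ be a field, let $p\geq 1$ and let $i_p>i_{p-1}>\cdots>i_1>i_0=0$ be integers. Let $u_j\in K[y,z]$, $0\leq j\leq p-1$, be monomials, and put $I_j=(u_j)$ for $0\le j\le p-1$. Let $I_p\subset K[y,z]$ be a proper nonzero monomial ideal. Suppose that there exists $0\leq q\leq p-1$ with $u_q\mid u_{q-1} \mid \cdots \mid u_1 \mid u_0$, the divisions being strict, such that $u_q,\ldots,u_{p-1}\notin I_p$ and, if $q\leq p-2$, then (i) $u_j\nmid u_k$ for all $p-1\geq k>j\geq q$, (ii) $((u_{q},u_{q+1},\ldots,u_{j-1}):u_j)$ is principal for all $q+1\leq j\leq p-1$, (iii) $((u_{q},u_{q+1},\ldots, u_{p-1}):u)$ is principal for any $u\in \mathcal G(I_p)$. Consider the ideal $$I=x^{i_p}I_p+(x^{i_{p-1}}u_{p-1},\ldots,x^{i_1}u_1,u_0)\subset R=K[x,y,z],$$ and assume that $$\mathcal{G}(I)=\mathcal{G}(x^{i_p}I_p)\cup\cdots\cup\mathcal{G}(x^{i_1}I_1)\cup\mathcal{G}(I_0).$$ Then $\operatorname{depth}(R/I)=1$.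
   Context: $\mathcal{G}(L)$ denotes the unique minimal set of monomial generators of a monomial ideal $L$. Monomial ideals of $K[y,z]$ are extended to $R$ when used inside $R$: $x^{i_j}I_j$ is the ideal of $R$ generated by the monomials $x^{i_j}u$, $u\in\mathcal G(I_j)$. A division $u\mid v$ is strict if $u\neq v$. The colon ideals in (ii) and (iii) are taken in $K[y,z]$. Depth is with respect to the graded maximal ideal generated by the variables. *)

theory Defs
  imports
    "HOL-Library.Poly_Mapping"
    "HOL-Library.Extended_Nat"
    "HOL-Library.Set_Algebras"
begin

text \<open>
  Polynomials over \<open>'a\<close> with variables in \<open>'v\<close> are finitely supported functions from exponent
  vectors \<open>'v \<Rightarrow>\<^sub>0 nat\<close> to \<open>'a\<close>; the product provided by \<^theory>\<open>HOL-Library.Poly_Mapping\<close> is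
  the convolution product.
\<close>

type_synonym ('v, 'a) mpoly = "('v \<Rightarrow>\<^sub>0 nat) \<Rightarrow>\<^sub>0 'a"

definition var :: "'v \<Rightarrow> ('v, 'a::comm_ring_1) mpoly" where
  "var v = Poly_Mapping.single (Poly_Mapping.single v 1) 1"

definition is_monomial :: "('v, 'a::comm_ring_1) mpoly \<Rightarrow> bool" where
  "is_monomial f \<longleftrightarrow> (\<exists>m. f = Poly_Mapping.single m 1)"


text \<open>The ideals of a commutative ring are the submodules of the ring as a module over itself.\<close>

definition ideal_gen :: "'r::comm_ring_1 set \<Rightarrow> 'r set" where
  "ideal_gen A = module.span (*) A"

definition is_principal :: "'r::comm_ring_1 set \<Rightarrow> bool" where
  "is_principal L \<longleftrightarrow> (\<exists>g. L = ideal_gen {g})"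

definition colon :: "'r::comm_ring_1 set \<Rightarrow> 'r \<Rightarrow> 'r set" where
  "colon L f = {g. g * f \<in> L}"


definition is_monomial_ideal :: "('v, 'a::comm_ring_1) mpoly set \<Rightarrow> bool" where
  "is_monomial_ideal L \<longleftrightarrow> (\<exists>A. (\<forall>a\<in>A. is_monomial a) \<and> L = ideal_gen A)"

definition is_min_mono_gens ::
  "('v, 'a::comm_ring_1) mpoly set \<Rightarrow> ('v, 'a) mpoly set \<Rightarrow> bool" where
  "is_min_mono_gens G L \<longleftrightarrow>
     (\<forall>g\<in>G. is_monomial g) \<and> ideal_gen G = L \<and> (\<forall>H. H \<subset> G \<longrightarrow> ideal_gen H \<noteq> L)"

text \<open>\<open>\<G>(L)\<close>; meaningful for monomial ideals only.\<close>

definition min_mono_gens :: "('v, 'a::comm_ring_1) mpoly set \<Rightarrow> ('v, 'a) mpoly set" where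
  "min_mono_gens L = (THE G. is_min_mono_gens G L)"


text \<open>
  The sequence \<open>f\<^sub>0, \<dots>, f\<^sub>n\<^sub>-\<^sub>1\<close> is regular on \<open>R/I\<close>: with \<open>J\<^sub>k = I + (f\<^sub>0, \<dots>, f\<^sub>k\<^sub>-\<^sub>1)\<close>, each \<open>f\<^sub>k\<close> is a
  nonzerodivisor on \<open>(R/I)/(f\<^sub>0, \<dots>, f\<^sub>k\<^sub>-\<^sub>1)(R/I) = R/J\<^sub>k\<close>, and \<open>R/J\<^sub>n\<close> is nonzero.
\<close>

definition regular_on_quot :: "'r::comm_ring_1 set \<Rightarrow> 'r list \<Rightarrow> bool" where
  "regular_on_quot I fs \<longleftrightarrow>
     (\<forall>k < length fs. \<forall>g.
        fs ! k * g \<in> I + ideal_gen (set (take k fs)) \<longrightarrow> g \<in> I + ideal_gen (set (take k fs))) \<and>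
     I + ideal_gen (set fs) \<noteq> UNIV"

text \<open>
  \<open>depth_quot \<mm> I\<close> is the depth of the module \<open>R/I\<close> with respect to \<open>\<mm>\<close>: the supremum of the
  lengths of the \<open>R/I\<close>-regular sequences in \<open>\<mm>\<close>. The value for \<open>R/I = 0\<close> is the junk value 0.
\<close>

definition depth_quot :: "'r::comm_ring_1 set \<Rightarrow> 'r set \<Rightarrow> enat" where
  "depth_quot \<mm> I = Sup {enat (length fs) | fs. set fs \<subseteq> \<mm> \<and> regular_on_quot I fs}"

definition max_graded_ideal :: "('v, 'a::comm_ring_1) mpoly set" where
  "max_graded_ideal = ideal_gen (range var)"


datatype var_yz = Y' | Z'

datatype var_xyz = X | Y | Z

text \<open>The inclusion \<open>K[y,z] \<subseteq> K[x,y,z]\<close>.\<close>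

definition embed_exp :: "(var_yz \<Rightarrow>\<^sub>0 nat) \<Rightarrow> (var_xyz \<Rightarrow>\<^sub>0 nat)" where
  "embed_exp m = Poly_Mapping.single Y (Poly_Mapping.lookup m Y') + Poly_Mapping.single Z (Poly_Mapping.lookup m Z')"

definition embed_yz :: "(var_yz, 'a::comm_ring_1) mpoly \<Rightarrow> (var_xyz, 'a) mpoly" where
  "embed_yz f = (\<Sum>m\<in>Poly_Mapping.keys f. Poly_Mapping.single (embed_exp m) (Poly_Mapping.lookup f m))"

text \<open>The ideal \<open>x\<^sup>nL\<close> of \<open>K[x,y,z]\<close>, for a monomial ideal \<open>L\<close> of \<open>K[y,z]\<close>.\<close>

definition x_pow_ideal ::
  "nat \<Rightarrow> (var_yz, 'a::comm_ring_1) mpoly set \<Rightarrow> (var_xyz, 'a) mpoly set" where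
  "x_pow_ideal n L = ideal_gen ((\<lambda>u. var X ^ n * embed_yz u) ` min_mono_gens L)"

end

theory Submission
  imports Defs
begin

text \<open>
  Write \<open>L\<^sub>j\<close> for the ideal \<open>(u\<^sub>0, \<dots>, u\<^sub>j)\<close> of \<open>K[y,z]\<close> if \<open>j < p\<close>, and put
  \<open>L\<^sub>p = (u\<^sub>0, \<dots>, u\<^sub>p\<^sub>-\<^sub>1) + I\<^sub>p\<close>. A monomial \<open>x\<^sup>k t\<close> with \<open>t\<close> in \<open>K[y,z]\<close> lies in \<open>I\<close> iff \<open>t\<close> lies in
  \<open>L\<^sub>j\<close> for some \<open>j\<close> with \<open>i\<^sub>j \<le> k\<close>, and everything below is read off from this chain of ideals in
  two variables.

  The depth is at least 1 because \<open>x + y + z\<close> is a nonzerodivisor on \<open>R/I\<close>. It is one as soon as every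
  monomial \<open>w\<close> outside \<open>I\<close> can be multiplied by all powers of some variable without entering \<open>I\<close>
  (\<open>sum_of_vars_nonzerodivisor\<close>). If the powers of \<open>x\<close> do not serve for \<open>w = x\<^sup>k t\<close>, then there is a first
  \<open>j\<close> with \<open>t \<in> L\<^sub>j\<close>, and \<open>k < i\<^sub>j\<close>. So \<open>t\<close> is a multiple \<open>e s\<close> of a generator \<open>e\<close> that is new in \<open>L\<^sub>j\<close>,
  and \<open>s\<close> is not in the colon ideal \<open>(L\<^sub>j\<^sub>-\<^sub>1 : e)\<close>. The hypotheses make all these colon ideals
  principal: up to \<open>j = q + 1\<close> the ideal \<open>L\<^sub>j\<^sub>-\<^sub>1\<close> is itself generated by \<open>u\<^sub>j\<^sub>-\<^sub>1\<close>, and later it is generated by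
  \<open>u\<^sub>q, \<dots>, u\<^sub>j\<^sub>-\<^sub>1\<close>, which is the situation of (ii) and (iii). A principal ideal of the factorial ring
  \<open>K[y,z]\<close> that contains \<open>y\<^sup>a s\<close> and \<open>z\<^sup>b s\<close> contains \<open>s\<close> (\<open>principal_ideal_saturated\<close>), so the
  powers of \<open>y\<close> or those of \<open>z\<close> keep \<open>t\<close> outside \<open>L\<^sub>j\<^sub>-\<^sub>1\<close>, and hence \<open>w\<close> outside \<open>I\<close> (\<open>ray_outside\<close>).

  The depth is at most 1 because \<open>(y, z)\<close> is contained in the annihilator of a nonzero element of
  \<open>R/I\<close>. Such elements form a graded module over \<open>R/(y, z) = K[x]\<close> with degrees bounded below, which
  is too small to carry two regular elements from the maximal ideal (\<open>no_regular_pair\<close>). To find one,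
  note that \<open>L\<^sub>p\<close> is not principal: by the minimality of the given generators no \<open>u\<^sub>j\<close> divides a
  generator of \<open>I\<^sub>p\<close>, and \<open>u\<^sub>p\<^sub>-\<^sub>1 \<notin> I\<^sub>p\<close>. The staircase of a monomial ideal in two variables that is not
  principal has an inner corner, a monomial \<open>h \<notin> L\<^sub>p\<close> with \<open>y h, z h \<in> L\<^sub>p\<close> (\<open>corner_outside\<close>); the
  class of \<open>x\<^sup>n h\<close> with \<open>n = i\<^sub>p\<close> is the element.
\<close>

section \<open>Divisibility of exponent vectors\<close>

abbreviation mon :: "('v \<Rightarrow>\<^sub>0 nat) \<Rightarrow> ('v, 'a::comm_ring_1) mpoly" where
  "mon m \<equiv> Poly_Mapping.single m 1"

text \<open>The relation \<open>\<le>\<close> on \<open>'v \<Rightarrow>\<^sub>0 nat\<close> is lexicographic, so divisibility of monomials needs a relation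
  of its own.\<close>

definition divides_exp :: "('v \<Rightarrow>\<^sub>0 nat) \<Rightarrow> ('v \<Rightarrow>\<^sub>0 nat) \<Rightarrow> bool" (infix "\<preceq>" 50) where
  "e \<preceq> m \<longleftrightarrow> (\<forall>v. Poly_Mapping.lookup e v \<le> Poly_Mapping.lookup m v)"

definition upset :: "('v \<Rightarrow>\<^sub>0 nat) set \<Rightarrow> ('v \<Rightarrow>\<^sub>0 nat) set" where
  "upset E = {m. \<exists>e\<in>E. e \<preceq> m}"

definition minimal_exps :: "('v \<Rightarrow>\<^sub>0 nat) set \<Rightarrow> ('v \<Rightarrow>\<^sub>0 nat) set" where
  "minimal_exps E = {e\<in>E. \<forall>e'\<in>E. e' \<preceq> e \<longrightarrow> e' = e}"

lemma divides_exp_refl [simp]: "e \<preceq> e"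
  by (simp add: divides_exp_def)

lemma divides_exp_trans: "a \<preceq> b \<Longrightarrow> b \<preceq> c \<Longrightarrow> a \<preceq> c"
  unfolding divides_exp_def using le_trans by blast

lemma divides_exp_antisym: "a \<preceq> b \<Longrightarrow> b \<preceq> a \<Longrightarrow> a = b"
  by (auto simp: divides_exp_def intro!: poly_mapping_eqI le_antisym)

lemma divides_exp_add [simp]: "a \<preceq> a + b"
  by (simp add: divides_exp_def lookup_add)

lemma zero_divides_exp [simp]: "0 \<preceq> a"
  by (simp add: divides_exp_def)

lemma divides_exp_diff: "a \<preceq> b \<Longrightarrow> a + (b - a) = b"
  by (auto simp: divides_exp_def lookup_add lookup_minus intro!: poly_mapping_eqI)

lemma divides_exp_zero_iff: "a \<preceq> 0 \<longleftrightarrow> a = 0"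
  using divides_exp_antisym zero_divides_exp divides_exp_refl by metis

lemma divides_exp_chain:
  assumes "\<And>j. j < q \<Longrightarrow> d (Suc j) \<preceq> d j" and "l \<le> j" "j \<le> q"
  shows "d j \<preceq> d l"
  using assms(2,3)
proof (induction j rule: dec_induct)
  case (step n)
  then show ?case using assms(1)[of n] divides_exp_trans by auto
qed simp

lemma upset_divides: "m \<in> upset E \<Longrightarrow> m \<preceq> n \<Longrightarrow> n \<in> upset E"
  unfolding upset_def using divides_exp_trans by blast

lemma upset_add: "m \<in> upset E \<Longrightarrow> m + n \<in> upset E"
  using upset_divides divides_exp_add by blast

lemma mem_upset: "e \<in> E \<Longrightarrow> e \<in> upset E"
  unfolding upset_def using divides_exp_refl by blast

lemma upset_UN: "upset (\<Union>j\<in>T. G j) = (\<Union>j\<in>T. upset (G j))"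
  by (auto simp: upset_def)

lemma upset_eqI:
  assumes "E' \<subseteq> E" and "\<And>e. e \<in> E \<Longrightarrow> \<exists>e'\<in>E'. e' \<preceq> e"
  shows "upset E = upset E'"
proof (intro equalityI subsetI)
  fix m assume "m \<in> upset E"
  then obtain e where "e \<in> E" "e \<preceq> m" by (auto simp: upset_def)
  with assms(2)[of e] show "m \<in> upset E'"
    unfolding upset_def using divides_exp_trans by blast
qed (use assms(1) in \<open>auto simp: upset_def\<close>)

text \<open>Divisibility of monomials is well-founded because a proper divisor has smaller degree;
  so every element of \<open>E\<close> lies above a minimal one, even when \<open>E\<close> is infinite.\<close>

lemma exists_minimal_divisor:
  assumes "e \<in> E"
  shows "\<exists>e'\<in>minimal_exps E. e' \<preceq> e"
proof -
  define deg :: "('a \<Rightarrow>\<^sub>0 nat) \<Rightarrow> nat"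
    where "deg m = (\<Sum>v\<in>Poly_Mapping.keys m. Poly_Mapping.lookup m v)" for m
  have deg_less: "deg a < deg b" if ab: "a \<preceq> b" "a \<noteq> b" for a b
  proof -
    have sub: "Poly_Mapping.keys a \<subseteq> Poly_Mapping.keys b"
      using ab(1) by (auto simp: divides_exp_def in_keys_iff) (metis less_le_trans)
    have "deg a = (\<Sum>v\<in>Poly_Mapping.keys b. Poly_Mapping.lookup a v)"
      unfolding deg_def using sub by (intro sum.mono_neutral_left) (auto simp: in_keys_iff)
    moreover obtain v where v: "Poly_Mapping.lookup a v < Poly_Mapping.lookup b v"
      using ab by (metis divides_exp_def le_neq_implies_less poly_mapping_eqI)
    then have "v \<in> Poly_Mapping.keys b" by (auto simp: in_keys_iff)
    then have "(\<Sum>v\<in>Poly_Mapping.keys b. Poly_Mapping.lookup a v) < deg b"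
      unfolding deg_def using ab(1) v
      by (intro sum_strict_mono_ex1) (auto simp: divides_exp_def)
    ultimately show ?thesis by simp
  qed
  from assms show ?thesis
  proof (induction "deg e" arbitrary: e rule: less_induct)
    case less
    show ?case
    proof (cases "e \<in> minimal_exps E")
      case False
      then obtain e' where "e' \<in> E" "e' \<preceq> e" "e' \<noteq> e"
        using less.prems by (auto simp: minimal_exps_def)
      then show ?thesis using less.hyps deg_less divides_exp_trans by meson
    qed (use divides_exp_refl in blast)
  qed
qed

lemma upset_minimal_exps: "upset (minimal_exps E) = upset E"
proof (rule upset_eqI[symmetric])
  show "minimal_exps E \<subseteq> E" by (auto simp: minimal_exps_def)
qed (rule exists_minimal_divisor)

lemma minimal_exps_upset: "minimal_exps (upset E) = minimal_exps E"
proof (intro equalityI subsetI)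
  fix e assume e: "e \<in> minimal_exps (upset E)"
  then obtain a where "a \<in> E" "a \<preceq> e" by (auto simp: minimal_exps_def upset_def)
  then have "a = e" using e by (auto simp: minimal_exps_def mem_upset)
  then show "e \<in> minimal_exps E"
    using e \<open>a \<in> E\<close> by (auto simp: minimal_exps_def mem_upset)
next
  fix e assume e: "e \<in> minimal_exps E"
  have "e' = e" if e': "e' \<in> upset E" "e' \<preceq> e" for e'
  proof -
    obtain a where "a \<in> E" "a \<preceq> e'" using e'(1) by (auto simp: upset_def)
    then show ?thesis
      using e e'(2) divides_exp_trans divides_exp_antisym by (fastforce simp: minimal_exps_def)
  qed
  then show "e \<in> minimal_exps (upset E)"
    using e by (auto simp: minimal_exps_def mem_upset)
qed

section \<open>Monomial ideals\<close>

lemma mon_mult_mon: "mon a * mon b = (mon (a + b) :: ('v, 'a::comm_ring_1) mpoly)"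
  by (simp add: mult_single)

lemma mon_eq_iff [simp]: "(mon a :: ('v, 'a::comm_ring_1) mpoly) = mon b \<longleftrightarrow> a = b"
  by (metis lookup_single_eq lookup_single_not_eq zero_neq_one)

lemma lookup_mon_mult:
  "Poly_Mapping.lookup (mon s * (f :: ('v, 'a::comm_ring_1) mpoly)) (s + k) = Poly_Mapping.lookup f k"
  by (simp add: lookup_mult lookup_single when_mult)

lemma keys_mon_mult:
  "Poly_Mapping.keys (mon s * (f :: ('v, 'a::comm_ring_1) mpoly)) = (+) s ` Poly_Mapping.keys f"
proof -
  have "Poly_Mapping.keys (mon s * f) \<subseteq> (+) s ` Poly_Mapping.keys f"
    using keys_mult[of "mon s" f] by auto
  then show ?thesis by (auto simp: in_keys_iff lookup_mon_mult)
qed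

lemma var_eq_mon: "var v = mon (Poly_Mapping.single v 1)"
  by (simp add: var_def)

lemma var_power: "(var v :: ('v, 'a::comm_ring_1) mpoly) ^ n = mon (Poly_Mapping.single v n)"
  by (induction n) (auto simp: var_eq_mon mult_single single_add[symmetric])

lemma module_times: "module ((*) :: 'r::comm_ring_1 \<Rightarrow> 'r \<Rightarrow> 'r)"
  by standard (simp_all add: algebra_simps)

lemma ideal_gen_add: "f \<in> ideal_gen A \<Longrightarrow> g \<in> ideal_gen A \<Longrightarrow> f + g \<in> ideal_gen A"
  unfolding ideal_gen_def by (rule module.span_add[OF module_times])

lemma ideal_gen_diff: "f \<in> ideal_gen A \<Longrightarrow> g \<in> ideal_gen A \<Longrightarrow> f - g \<in> ideal_gen A"
  unfolding ideal_gen_def by (rule module.span_diff[OF module_times])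

lemma ideal_gen_zero: "0 \<in> ideal_gen A"
  unfolding ideal_gen_def by (rule module.span_zero[OF module_times])

lemma ideal_gen_mult: "f \<in> ideal_gen A \<Longrightarrow> g * f \<in> ideal_gen A"
  unfolding ideal_gen_def by (rule module.span_scale[OF module_times])

lemma ideal_gen_base: "a \<in> A \<Longrightarrow> a \<in> ideal_gen A"
  unfolding ideal_gen_def by (rule module.span_base[OF module_times])

lemma ideal_gen_empty: "ideal_gen {} = {0}"
  unfolding ideal_gen_def by (rule module.span_empty[OF module_times])

lemma ideal_gen_singleton: "ideal_gen {g} = range (\<lambda>k. k * g)"
  unfolding ideal_gen_def by (rule module.span_singleton[OF module_times])

lemma ideal_gen_Un: "ideal_gen (A \<union> B) = ideal_gen A + ideal_gen B"
  unfolding ideal_gen_def module.span_Un[OF module_times] by (auto simp: set_plus_def)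

lemma ideal_gen_insert: "f \<in> ideal_gen (insert a A) \<longleftrightarrow> (\<exists>k. f - k * a \<in> ideal_gen A)"
  unfolding ideal_gen_def by (rule module.span_breakdown_eq[OF module_times])

text \<open>Membership in a monomial ideal is decided monomial by monomial: the polynomials supported in an
  up-closed set of exponents form an ideal, and each of their terms is a multiple of a generator.\<close>

lemma ideal_gen_mon:
  "ideal_gen (mon ` E) = {f :: ('v, 'a::comm_ring_1) mpoly. Poly_Mapping.keys f \<subseteq> upset E}"
    (is "_ = ?S")
proof (intro equalityI)
  have "module.subspace (*) ?S"
  proof (rule module.subspaceI[OF module_times])
    fix f g :: "('v, 'a) mpoly"
    assume "f \<in> ?S" "g \<in> ?S"
    then show "f + g \<in> ?S" using keys_add[of f g] by auto
  next
    fix c f :: "('v, 'a) mpoly"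
    assume "f \<in> ?S"
    then have "a + b \<in> upset E" if "b \<in> Poly_Mapping.keys f" for a b
      using that upset_add[of b E a] by (auto simp: add.commute)
    then show "c * f \<in> ?S" using keys_mult[of c f] by auto
  qed simp
  moreover have "mon ` E \<subseteq> ?S" by (auto simp: mem_upset)
  ultimately show "ideal_gen (mon ` E) \<subseteq> ?S"
    unfolding ideal_gen_def by (intro module.span_minimal[OF module_times])
next
  show "?S \<subseteq> ideal_gen (mon ` E)"
  proof
    fix f assume "f \<in> ?S"
    have "Poly_Mapping.single m c \<in> ideal_gen (mon ` E :: ('v, 'a) mpoly set)"
      if "m \<in> upset E" for m c
    proof -
      obtain e where e: "e \<in> E" "e \<preceq> m" using \<open>m \<in> upset E\<close> by (auto simp: upset_def)
      then have "Poly_Mapping.single m c = Poly_Mapping.single (m - e) c * mon e"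
        by (simp add: mult_single add.commute[of _ e] divides_exp_diff)
      then show ?thesis using e(1) by (simp add: ideal_gen_mult ideal_gen_base)
    qed
    then have "(\<Sum>m\<in>Poly_Mapping.keys f. Poly_Mapping.single m (Poly_Mapping.lookup f m))
        \<in> ideal_gen (mon ` E)"
      using \<open>f \<in> ?S\<close> unfolding ideal_gen_def by (intro module.span_sum[OF module_times]) auto
    moreover have "(\<Sum>m\<in>Poly_Mapping.keys f. Poly_Mapping.single m (Poly_Mapping.lookup f m)) = f"
      by (intro poly_mapping_eqI) (auto simp: lookup_sum lookup_single when_def in_keys_iff sum.delta)
    ultimately show "f \<in> ideal_gen (mon ` E)" by simp
  qed
qed

lemma mon_in_ideal_gen [simp]:
  "(mon m :: ('v, 'a::comm_ring_1) mpoly) \<in> ideal_gen (mon ` E) \<longleftrightarrow> m \<in> upset E"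
  by (simp add: ideal_gen_mon)

lemma ideal_gen_mon_eq_iff:
  "ideal_gen (mon ` E) = (ideal_gen (mon ` E') :: ('v, 'a::comm_ring_1) mpoly set)
     \<longleftrightarrow> upset E = upset E'"
proof
  assume eq: "ideal_gen (mon ` E) = (ideal_gen (mon ` E') :: ('v, 'a) mpoly set)"
  have "m \<in> upset E \<longleftrightarrow> m \<in> upset E'" for m
    using arg_cong[OF eq, of "\<lambda>L. mon m \<in> L"] unfolding mon_in_ideal_gen .
  then show "upset E = upset E'" by blast
qed (simp add: ideal_gen_mon)

lemma mon_dvd_iff:
  "(mon a :: ('v, 'a::comm_ring_1) mpoly) dvd mon b \<longleftrightarrow> a \<preceq> b"
proof
  assume "(mon a :: ('v, 'a) mpoly) dvd mon b"
  then have "(mon b :: ('v, 'a) mpoly) \<in> ideal_gen (mon ` {a})"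
    by (auto simp: dvd_def ideal_gen_singleton mult.commute)
  then show "a \<preceq> b" by (simp only: mon_in_ideal_gen) (simp add: upset_def)
next
  assume "a \<preceq> b"
  then have "(mon b :: ('v, 'a) mpoly) = mon a * mon (b - a)"
    by (simp add: mon_mult_mon divides_exp_diff)
  then show "(mon a :: ('v, 'a) mpoly) dvd mon b" by (rule dvdI)
qed

lemma monomials_eq_image:
  assumes "\<forall>g\<in>G. is_monomial g"
  shows "\<exists>E. G = mon ` E"
proof
  show "G = mon ` {e. mon e \<in> G}" using assms by (auto simp: is_monomial_def)
qed

text \<open>Minimal elements under divisibility generate the same ideal, and none of them can be omitted since
  no other one divides it. Conversely, a generating set without superfluous elements has to consist of
  minimal elements; this gives the uniqueness behind the definite description.\<close>

lemma min_mono_gens_mon: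
  "min_mono_gens (ideal_gen (mon ` E)) = (mon ` minimal_exps E :: ('v, 'a::comm_ring_1) mpoly set)"
proof -
  have min: "ideal_gen (mon ` F) \<noteq> (ideal_gen (mon ` E) :: ('v, 'a) mpoly set)"
    if F: "F \<subset> minimal_exps E" for E F :: "('v \<Rightarrow>\<^sub>0 nat) set"
  proof
    assume "ideal_gen (mon ` F) = (ideal_gen (mon ` E) :: ('v, 'a) mpoly set)"
    then have eq: "upset F = upset E" by (simp add: ideal_gen_mon_eq_iff)
    obtain e where e: "e \<in> minimal_exps E" "e \<notin> F" using F by auto
    then have "e \<in> upset F" unfolding eq by (auto simp: minimal_exps_def mem_upset)
    then obtain e' where "e' \<in> F" "e' \<preceq> e" by (auto simp: upset_def)
    then show False using e F by (auto simp: minimal_exps_def)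
  qed
  show ?thesis
    unfolding min_mono_gens_def
  proof (rule the_equality)
    have "ideal_gen (mon ` minimal_exps E) = (ideal_gen (mon ` E) :: ('v, 'a) mpoly set)"
      by (simp add: ideal_gen_mon_eq_iff upset_minimal_exps)
    moreover have "ideal_gen H \<noteq> ideal_gen (mon ` E)"
      if H: "H \<subset> mon ` minimal_exps E" for H :: "('v, 'a) mpoly set"
    proof -
      obtain F where F: "F \<subseteq> minimal_exps E" "H = mon ` F"
        using H by (meson psubset_imp_subset subset_imageE)
      then have "F \<subset> minimal_exps E" using H by blast
      then show ?thesis unfolding F(2) by (rule min)
    qed
    moreover have "\<forall>g\<in>mon ` minimal_exps E. is_monomial (g :: ('v, 'a) mpoly)"
      by (auto simp: is_monomial_def)
    ultimately show "is_min_mono_gens (mon ` minimal_exps E :: ('v, 'a) mpoly set) (ideal_gen (mon ` E))"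
      unfolding is_min_mono_gens_def by blast
  next
    fix G :: "('v, 'a) mpoly set"
    assume G: "is_min_mono_gens G (ideal_gen (mon ` E))"
    then have "\<forall>g\<in>G. is_monomial g" and gen: "ideal_gen G = ideal_gen (mon ` E)"
      and minG: "\<And>H. H \<subset> G \<Longrightarrow> ideal_gen H \<noteq> ideal_gen (mon ` E)"
      unfolding is_min_mono_gens_def by blast+
    then obtain F where F: "G = mon ` F"
      using monomials_eq_image by blast
    have "upset F = upset E"
      using gen unfolding F by (simp only: ideal_gen_mon_eq_iff)
    then have "minimal_exps F = minimal_exps E"
      using minimal_exps_upset[of F] minimal_exps_upset[of E] by simp
    moreover have "minimal_exps F = F"
    proof (rule ccontr)
      assume "minimal_exps F \<noteq> F"
      then have "minimal_exps F \<subset> F" by (auto simp: minimal_exps_def)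
      moreover have "inj (mon :: _ \<Rightarrow> ('v, 'a) mpoly)" by (intro injI) simp
      ultimately have "mon ` minimal_exps F \<subset> G"
        unfolding F by (simp add: inj_image_subset_iff psubset_eq inj_image_eq_iff)
      moreover have "ideal_gen (mon ` minimal_exps F) = (ideal_gen (mon ` E) :: ('v, 'a) mpoly set)"
        unfolding ideal_gen_mon_eq_iff by (simp add: upset_minimal_exps \<open>upset F = upset E\<close>)
      ultimately show False using minG by blast
    qed
    ultimately show "G = mon ` minimal_exps E" by (simp add: F)
  qed
qed

section \<open>Depth of a monomial quotient\<close>

lemma max_graded_ideal_eq:
  "(max_graded_ideal :: ('v, 'a::comm_ring_1) mpoly set) = {f. 0 \<notin> Poly_Mapping.keys f}"
proof -
  have "range var = (mon ` range (\<lambda>v. Poly_Mapping.single v 1) :: ('v, 'a) mpoly set)"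
    by (auto simp: var_eq_mon)
  moreover have "upset (range (\<lambda>v. Poly_Mapping.single v 1)) = - {0 :: 'v \<Rightarrow>\<^sub>0 nat}"
  proof -
    have "\<exists>v. Poly_Mapping.single v 1 \<preceq> m" if m: "m \<noteq> 0" for m :: "'v \<Rightarrow>\<^sub>0 nat"
    proof -
      obtain v where "Poly_Mapping.lookup m v \<noteq> 0"
        using m by (metis lookup_zero poly_mapping_eqI)
      then show ?thesis by (auto simp: divides_exp_def lookup_single when_def intro!: exI[of _ v])
    qed
    moreover have "Poly_Mapping.single v 1 \<noteq> (0 :: 'v \<Rightarrow>\<^sub>0 nat)" for v
      by (metis lookup_single_eq lookup_zero zero_neq_one)
    ultimately show ?thesis by (auto simp: upset_def divides_exp_zero_iff)
  qed
  ultimately show ?thesis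
    unfolding max_graded_ideal_def by (auto simp: ideal_gen_mon)
qed

text \<open>For the upper bound only the first two elements of a longer regular sequence matter, and of these
  only that they are successive nonzerodivisors.\<close>

lemma depth_quot_eq_1I:
  assumes "f \<in> M" and "regular_on_quot I [f]"
    and no_pair: "\<And>f\<^sub>1 f\<^sub>2. f\<^sub>1 \<in> M \<Longrightarrow> f\<^sub>2 \<in> M \<Longrightarrow> \<forall>g. f\<^sub>1 * g \<in> I \<longrightarrow> g \<in> I \<Longrightarrow>
      \<forall>g. f\<^sub>2 * g \<in> I + ideal_gen {f\<^sub>1} \<longrightarrow> g \<in> I + ideal_gen {f\<^sub>1} \<Longrightarrow> False"
  shows "depth_quot M I = 1"
proof -
  have I0: "I + {0} = I" by (simp add: set_plus_def)
  have "length fs \<le> 1" if fs: "set fs \<subseteq> M" "regular_on_quot I fs" for fs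
  proof (rule ccontr)
    assume "\<not> length fs \<le> 1"
    then obtain f\<^sub>1 f\<^sub>2 gs where eq: "fs = f\<^sub>1 # f\<^sub>2 # gs"
      by (cases fs; cases "tl fs") auto
    have reg: "\<forall>g. fs ! k * g \<in> I + ideal_gen (set (take k fs)) \<longrightarrow>
        g \<in> I + ideal_gen (set (take k fs))" if "k < length fs" for k
      using fs(2) that by (simp add: regular_on_quot_def)
    show False
      using no_pair[of f\<^sub>1 f\<^sub>2] reg[of 0] reg[of 1] fs(1)
      by (simp add: eq ideal_gen_empty I0)
  qed
  then have "\<And>d. d \<in> {enat (length fs) | fs. set fs \<subseteq> M \<and> regular_on_quot I fs} \<Longrightarrow> d \<le> 1"
    by (auto simp: one_enat_def)
  moreover have "1 \<in> {enat (length fs) | fs. set fs \<subseteq> M \<and> regular_on_quot I fs}"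
    using assms(1,2) by (auto simp: one_enat_def intro!: exI[of _ "[f]"])
  ultimately show ?thesis
    unfolding depth_quot_def by (intro antisym Sup_least Sup_upper)
qed

text \<open>If \<open>g\<close> has a term outside the ideal, then fix a variable \<open>v\<close> such that some term of \<open>g\<close> stays
  outside under multiplication with all powers of \<open>v\<close>, and let \<open>w\<close> be such a term with the largest
  exponent of \<open>v\<close>. In the product the monomial \<open>v w\<close> arises only as \<open>v\<close> times \<open>w\<close>: any other way uses a
  term of \<open>g\<close> with a larger exponent of \<open>v\<close>, which would also stay outside. Hence \<open>v w\<close> survives,
  although it is not in the ideal.\<close>

lemma sum_of_vars_nonzerodivisor:
  fixes g :: "('v::finite, 'a::comm_ring_1) mpoly"
  assumes ray: "\<And>w. w \<notin> upset E \<Longrightarrow> \<exists>v. \<forall>n. w + Poly_Mapping.single v n \<notin> upset E"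
    and prod: "(\<Sum>v\<in>UNIV. var v) * g \<in> ideal_gen (mon ` E)"
  shows "g \<in> ideal_gen (mon ` E)"
proof (rule ccontr)
  assume "g \<notin> ideal_gen (mon ` E)"
  then obtain w\<^sub>0 where "w\<^sub>0 \<in> Poly_Mapping.keys g" "w\<^sub>0 \<notin> upset E"
    by (auto simp: ideal_gen_mon)
  obtain v where v: "\<forall>n. w\<^sub>0 + Poly_Mapping.single v n \<notin> upset E"
    using ray[OF \<open>w\<^sub>0 \<notin> upset E\<close>] ..
  define S where "S = {w \<in> Poly_Mapping.keys g. \<forall>n. w + Poly_Mapping.single v n \<notin> upset E}"
  have "finite S" "S \<noteq> {}"
    using \<open>w\<^sub>0 \<in> Poly_Mapping.keys g\<close> v by (auto simp: S_def)
  then have "Max ((\<lambda>w. Poly_Mapping.lookup w v) ` S) \<in> (\<lambda>w. Poly_Mapping.lookup w v) ` S"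
    by (intro Max_in) auto
  then obtain w where w: "w \<in> S"
    and "Max ((\<lambda>w. Poly_Mapping.lookup w v) ` S) = Poly_Mapping.lookup w v"
    by (rule imageE)
  then have max: "Poly_Mapping.lookup w' v \<le> Poly_Mapping.lookup w v" if "w' \<in> S" for w'
    using Max_ge[of "(\<lambda>w. Poly_Mapping.lookup w v) ` S" "Poly_Mapping.lookup w' v"]
      \<open>finite S\<close> that by simp
  let ?vw = "Poly_Mapping.single v 1 + w"
  \<comment> \<open>Otherwise \<open>v w = s q\<close> with \<open>q\<close> in the support of \<open>g\<close>. By maximality some \<open>v\<^sup>n q\<close> is in the
    ideal, and then so is its multiple \<open>s v\<^sup>n q = v\<^sup>n v w\<close>.\<close>
  have others: "Poly_Mapping.lookup (var s * g) ?vw = 0" if "s \<noteq> v" for s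
  proof (rule ccontr)
    assume "\<not> ?thesis"
    then have "?vw \<in> (+) (Poly_Mapping.single s 1) ` Poly_Mapping.keys g"
      by (simp add: in_keys_iff var_eq_mon flip: keys_mon_mult)
    then obtain q where q: "q \<in> Poly_Mapping.keys g" "?vw = Poly_Mapping.single s 1 + q" by blast
    have "Poly_Mapping.lookup q v = Suc (Poly_Mapping.lookup w v)"
      using arg_cong[OF q(2), of "\<lambda>m. Poly_Mapping.lookup m v"] that
      by (simp add: lookup_add lookup_single when_def)
    then have "q \<notin> S" using max[of q] by auto
    then obtain n where "q + Poly_Mapping.single v n \<in> upset E" using q(1) by (auto simp: S_def)
    then have "q + Poly_Mapping.single v n + Poly_Mapping.single s 1 \<in> upset E" by (rule upset_add)
    also have "q + Poly_Mapping.single v n + Poly_Mapping.single s 1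
        = ?vw + Poly_Mapping.single v n"
      unfolding q(2) by (simp add: ac_simps)
    also have "\<dots> = w + Poly_Mapping.single v (Suc n)"
      using single_add[of v 1 n] by (simp add: ac_simps)
    finally show False using w by (simp add: S_def)
  qed
  have "Poly_Mapping.lookup ((\<Sum>s\<in>UNIV. var s) * g) ?vw
      = (\<Sum>s\<in>UNIV. Poly_Mapping.lookup (var s * g) ?vw)"
    by (simp add: sum_distrib_right lookup_sum)
  also have "\<dots> = Poly_Mapping.lookup (var v * g) ?vw"
    using others by (subst sum.remove[of _ v]) auto
  also have "\<dots> = Poly_Mapping.lookup g w"
    by (simp add: var_eq_mon lookup_mon_mult)
  also have "\<dots> \<noteq> 0" using w by (simp add: S_def in_keys_iff)
  finally have "?vw \<in> upset E"
    using prod by (auto simp: ideal_gen_mon in_keys_iff)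
  then show False using w by (auto simp: S_def add.commute)
qed

text \<open>Let \<open>N\<close> consist of the \<open>n\<close> with \<open>v n \<in> I\<close> for all variables \<open>v \<noteq> x\<close>. Modulo \<open>I\<close>, an element \<open>f\<close> of
  the graded maximal ideal acts on \<open>N\<close> as \<open>x\<close> times some \<open>a\<close>. If \<open>f\<^sub>1, f\<^sub>2\<close> act as \<open>x a\<close> and \<open>x b\<close>, then
  \<open>f\<^sub>2 (a h) = x a b h = f\<^sub>1 (b h)\<close> for \<open>h\<close> in \<open>N\<close>; so regularity of \<open>f\<^sub>2\<close> gives \<open>a h = c f\<^sub>1\<close> for
  some \<open>c\<close>. Regularity of \<open>f\<^sub>1\<close> gives \<open>c \<in> N\<close>, and since \<open>f\<^sub>1 h = x a h = f\<^sub>1 x c\<close>, also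
  \<open>h = x c\<close>, all modulo \<open>I\<close>. This
  divides \<open>h\<close> by \<open>x\<close> inside \<open>N\<close>, which is impossible for a monomial \<open>h \<notin> I\<close> in \<open>N\<close> whose
  \<open>x\<close>-exponent is least.\<close>

lemma no_regular_pair:
  fixes f\<^sub>1 f\<^sub>2 :: "('v, 'a::comm_ring_1) mpoly"
  assumes h\<^sub>0: "h\<^sub>0 \<notin> upset E" "\<And>v. v \<noteq> x \<Longrightarrow> Poly_Mapping.single v 1 + h\<^sub>0 \<in> upset E"
    and f: "f\<^sub>1 \<in> max_graded_ideal" "f\<^sub>2 \<in> max_graded_ideal"
    and I: "I = ideal_gen (mon ` E)"
    and reg1: "\<And>g. f\<^sub>1 * g \<in> I \<Longrightarrow> g \<in> I"
    and reg2: "\<And>g. f\<^sub>2 * g \<in> I + ideal_gen {f\<^sub>1} \<Longrightarrow> g \<in> I + ideal_gen {f\<^sub>1}"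
  shows False
proof -
  let ?socle = "\<lambda>h. h \<notin> upset E \<and> (\<forall>v. v \<noteq> x \<longrightarrow> Poly_Mapping.single v 1 + h \<in> upset E)"
  obtain h where h: "?socle h"
    and least: "\<And>h'. ?socle h' \<Longrightarrow> Poly_Mapping.lookup h x \<le> Poly_Mapping.lookup h' x"
    using ex_has_least_nat[of ?socle h\<^sub>0 "\<lambda>h. Poly_Mapping.lookup h x"] h\<^sub>0 by auto
  define N where "N = {n. \<forall>v. v \<noteq> x \<longrightarrow> var v * n \<in> I}"
  have kill: "r * n \<in> I" if r: "r \<in> ideal_gen (var ` (- {x}))" and n: "n \<in> N" for r n
  proof -
    have "module.subspace (*) {r. r * n \<in> I}"
      by (rule module.subspaceI[OF module_times])
        (auto simp: I distrib_right mult.assoc ideal_gen_add ideal_gen_mult ideal_gen_zero)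
    then have "ideal_gen (var ` (- {x})) \<subseteq> {r. r * n \<in> I}"
      unfolding ideal_gen_def using n
      by (intro module.span_minimal[OF module_times]) (auto simp: N_def)
    then show ?thesis using r by blast
  qed
  have split: "\<exists>a. f - a * var x \<in> ideal_gen (var ` (- {x}))" if "f \<in> max_graded_ideal"
    for f :: "('v, 'a) mpoly"
  proof -
    have "range var = insert (var x) (var ` (- {x}) :: ('v, 'a) mpoly set)" by auto
    then show ?thesis using that ideal_gen_insert unfolding max_graded_ideal_def by metis
  qed
  obtain a b where a: "f\<^sub>1 - a * var x \<in> ideal_gen (var ` (- {x}))"
    and b: "f\<^sub>2 - b * var x \<in> ideal_gen (var ` (- {x}))"
    using split f by blast
  have Idiff: "\<And>f g. f \<in> I \<Longrightarrow> g \<in> I \<Longrightarrow> f - g \<in> I" unfolding I by (rule ideal_gen_diff)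
  have Imult: "\<And>f g. f \<in> I \<Longrightarrow> g * f \<in> I" unfolding I by (rule ideal_gen_mult)
  have hN: "mon h \<in> N"
    using h by (simp add: N_def I var_eq_mon mult_single)
  have "a * mon h \<in> I + ideal_gen {f\<^sub>1}"
  proof (rule reg2)
    have "f\<^sub>2 * (a * mon h) = (a * ((f\<^sub>2 - b * var x) * mon h) - b * ((f\<^sub>1 - a * var x) * mon h))
        + (b * mon h) * f\<^sub>1"
      by (simp add: algebra_simps)
    moreover have "a * ((f\<^sub>2 - b * var x) * mon h) - b * ((f\<^sub>1 - a * var x) * mon h) \<in> I"
      by (rule Idiff[OF Imult[OF kill[OF b hN]] Imult[OF kill[OF a hN]]])
    moreover have "(b * mon h) * f\<^sub>1 \<in> ideal_gen {f\<^sub>1}" by (simp add: ideal_gen_singleton)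
    ultimately show "f\<^sub>2 * (a * mon h) \<in> I + ideal_gen {f\<^sub>1}"
      by (simp only: set_plus_intro)
  qed
  then obtain k c where "k \<in> I" "a * mon h = k + c * f\<^sub>1"
    by (auto simp: set_plus_def ideal_gen_singleton)
  then have c: "a * mon h - c * f\<^sub>1 \<in> I" by simp
  have cN: "c \<in> N"
  proof -
    have "var v * c \<in> I" if "v \<noteq> x" for v
    proof (rule reg1)
      have "f\<^sub>1 * (var v * c) = a * (var v * mon h) - var v * (a * mon h - c * f\<^sub>1)"
        by (simp add: algebra_simps)
      moreover have "var v * mon h \<in> I" using hN that by (simp add: N_def)
      then have "a * (var v * mon h) - var v * (a * mon h - c * f\<^sub>1) \<in> I"
        by (rule Idiff[OF Imult Imult[OF c]])
      ultimately show "f\<^sub>1 * (var v * c) \<in> I" by simp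
    qed
    then show ?thesis by (simp add: N_def)
  qed
  have "mon h - var x * c \<in> I"
  proof (rule reg1)
    have "f\<^sub>1 * (mon h - var x * c)
        = var x * (a * mon h - c * f\<^sub>1) + (f\<^sub>1 - a * var x) * mon h"
      by (simp add: algebra_simps)
    moreover have "var x * (a * mon h - c * f\<^sub>1) + (f\<^sub>1 - a * var x) * mon h \<in> I"
      using Imult[OF c] kill[OF a hN] unfolding I by (rule ideal_gen_add)
    ultimately show "f\<^sub>1 * (mon h - var x * c) \<in> I" by simp
  qed
  then have "Poly_Mapping.lookup (mon h - var x * c) h = 0"
    using h by (auto simp: I ideal_gen_mon in_keys_iff)
  then have "h \<in> Poly_Mapping.keys (var x * c)"
    by (auto simp: lookup_minus in_keys_iff)
  then obtain h' where h': "h' \<in> Poly_Mapping.keys c" "h = Poly_Mapping.single x 1 + h'"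
    by (auto simp: var_eq_mon keys_mon_mult)
  have "Poly_Mapping.single v 1 + h' \<in> upset E" if "v \<noteq> x" for v
  proof -
    have "var v * c \<in> I" using cN that by (simp add: N_def)
    then show ?thesis using h'(1) by (auto simp: I ideal_gen_mon var_eq_mon keys_mon_mult)
  qed
  moreover have "h' \<notin> upset E"
    using h upset_add[of h' E "Poly_Mapping.single x 1"] by (auto simp: h'(2) add.commute)
  ultimately show False using least[of h'] by (simp add: h'(2) lookup_add)
qed

section \<open>Principal colon ideals\<close>

text \<open>Only the existence of a linear order matters: it makes \<open>K[y,z]\<close> an instance of the class of integral
  domains.\<close>

instantiation var_yz :: linorder
begin

definition less_eq_var_yz :: "var_yz \<Rightarrow> var_yz \<Rightarrow> bool" where
  "less_eq_var_yz a b \<longleftrightarrow> a = Y' \<or> b = Z'"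

definition less_var_yz :: "var_yz \<Rightarrow> var_yz \<Rightarrow> bool" where
  "less_var_yz a b \<longleftrightarrow> a = Y' \<and> b = Z'"

instance
proof
  fix a b c :: var_yz
  show "a < b \<longleftrightarrow> a \<le> b \<and> \<not> b \<le> a"
    by (cases a; cases b) (auto simp: less_eq_var_yz_def less_var_yz_def)
  show "a \<le> a" "a \<le> b \<Longrightarrow> b \<le> c \<Longrightarrow> a \<le> c" "a \<le> b \<Longrightarrow> b \<le> a \<Longrightarrow> a = b" "a \<le> b \<or> b \<le> a"
    by (cases a; cases b; cases c; auto simp: less_eq_var_yz_def)+
qed

end

text \<open>If \<open>v\<^sup>a t = A g\<close> and \<open>w\<^sup>b t = B g\<close>, then cancelling \<open>g\<close> gives \<open>w\<^sup>b A = v\<^sup>a B\<close>; as \<open>v\<close> and \<open>w\<close> are different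
  variables, \<open>v\<^sup>a\<close> divides \<open>A\<close>, and the quotient times \<open>g\<close> is \<open>t\<close>.\<close>

lemma principal_ideal_saturated:
  fixes L :: "('v::linorder, 'a::idom) mpoly set"
  assumes "is_principal L" and "v \<noteq> w"
    and "mon (Poly_Mapping.single v a + t) \<in> L" and "mon (Poly_Mapping.single w b + t) \<in> L"
  shows "mon t \<in> L"
proof -
  let ?v = "Poly_Mapping.single v a" and ?w = "Poly_Mapping.single w b"
  obtain g where L: "L = range (\<lambda>k. k * g)"
    using assms(1) by (auto simp: is_principal_def ideal_gen_singleton)
  obtain A where A: "mon ?v * mon t = A * g"
    using assms(3) by (auto simp: L mon_mult_mon)
  obtain B where B: "mon ?w * mon t = B * g"
    using assms(4) by (auto simp: L mon_mult_mon)
  have mon_nonzero: "mon m \<noteq> (0 :: ('v, 'a) mpoly)" for m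
    by (metis lookup_single_eq lookup_zero zero_neq_one)
  have "mon (?v + t) \<noteq> (0 :: ('v, 'a) mpoly)" by (rule mon_nonzero)
  then have "g \<noteq> 0" using A by (auto simp: mon_mult_mon)
  have "mon ?w * A * g = mon ?v * B * g"
    unfolding mult.assoc A[symmetric] B[symmetric] by (rule mult.left_commute)
  then have AB: "mon ?w * A = mon ?v * B" using \<open>g \<noteq> 0\<close> by simp
  have "?v \<preceq> k" if k: "k \<in> Poly_Mapping.keys A" for k
  proof -
    have "?w + k \<in> (+) ?w ` Poly_Mapping.keys A" using k by blast
    then have "?w + k \<in> (+) ?v ` Poly_Mapping.keys B"
      by (simp add: keys_mon_mult[symmetric] AB)
    then obtain l where "?w + k = ?v + l" by blast
    from arg_cong[OF this, of "\<lambda>m. Poly_Mapping.lookup m v"] have "a \<le> Poly_Mapping.lookup k v"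
      using \<open>v \<noteq> w\<close> by (simp add: lookup_add lookup_single when_def)
    then show ?thesis by (simp add: divides_exp_def lookup_single when_def)
  qed
  then have "A \<in> ideal_gen (mon ` {?v})"
    unfolding ideal_gen_mon by (auto simp: upset_def)
  then obtain C where "A = C * mon ?v" by (auto simp: ideal_gen_singleton)
  then have "mon ?v * mon t = mon ?v * (C * g)" using A by (simp add: ac_simps)
  then have "mon t = C * g" using mon_nonzero[of ?v] by (simp only: mult_cancel_left simp_thms)
  then show ?thesis by (auto simp: L)
qed

text \<open>The colon ideal is generated by \<open>m / gcd(m, e)\<close>, whose exponents are the truncated differences
  \<open>m - e\<close>.\<close>

lemma is_principal_colon_mon:
  "is_principal (colon (ideal_gen {mon m :: ('v, 'a::comm_ring_1) mpoly}) (mon e))"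
proof -
  have "m \<preceq> e + k \<longleftrightarrow> m - e \<preceq> k" for k
    by (simp add: divides_exp_def lookup_add lookup_minus le_diff_conv add.commute)
  then have "colon (ideal_gen (mon ` {m})) (mon e) = (ideal_gen (mon ` {m - e}) :: ('v, 'a) mpoly set)"
    unfolding colon_def ideal_gen_mon
    by (auto simp: upset_def mult.commute[of _ "mon e"] keys_mon_mult)
  then show ?thesis by (auto simp: is_principal_def)
qed

section \<open>Monomials in \<open>x\<close>, \<open>y\<close>, \<open>z\<close>\<close>

instance var_xyz :: finite
proof
  have "(UNIV :: var_xyz set) \<subseteq> {X, Y, Z}"
  proof
    show "v \<in> {X, Y, Z}" for v by (cases v) auto
  qed
  then show "finite (UNIV :: var_xyz set)" by (rule finite_subset) simp
qed

lemma all_var_xyz: "(\<forall>v. P v) \<longleftrightarrow> P X \<and> P Y \<and> P Z"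
proof -
  have "P v" if "P X \<and> P Y \<and> P Z" for v using that by (cases v) auto
  then show ?thesis by blast
qed

lemma all_var_yz: "(\<forall>v. P v) \<longleftrightarrow> P Y' \<and> P Z'"
proof -
  have "P v" if "P Y' \<and> P Z'" for v using that by (cases v) auto
  then show ?thesis by blast
qed

definition x_exp :: "nat \<Rightarrow> (var_yz \<Rightarrow>\<^sub>0 nat) \<Rightarrow> (var_xyz \<Rightarrow>\<^sub>0 nat)" where
  "x_exp n m = Poly_Mapping.single X n + embed_exp m"

definition yz_part :: "(var_xyz \<Rightarrow>\<^sub>0 nat) \<Rightarrow> (var_yz \<Rightarrow>\<^sub>0 nat)" where
  "yz_part w = Poly_Mapping.single Y' (Poly_Mapping.lookup w Y)
     + Poly_Mapping.single Z' (Poly_Mapping.lookup w Z)"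

lemma lookup_x_exp [simp]:
  "Poly_Mapping.lookup (x_exp n m) X = n"
  "Poly_Mapping.lookup (x_exp n m) Y = Poly_Mapping.lookup m Y'"
  "Poly_Mapping.lookup (x_exp n m) Z = Poly_Mapping.lookup m Z'"
  by (simp_all add: x_exp_def embed_exp_def lookup_add lookup_single)

lemma lookup_yz_part [simp]:
  "Poly_Mapping.lookup (yz_part w) Y' = Poly_Mapping.lookup w Y"
  "Poly_Mapping.lookup (yz_part w) Z' = Poly_Mapping.lookup w Z"
  by (simp_all add: yz_part_def lookup_add lookup_single)

lemma exp_yz_eqI:
  assumes "Poly_Mapping.lookup a Y' = Poly_Mapping.lookup b Y'"
    and "Poly_Mapping.lookup a Z' = Poly_Mapping.lookup b Z'"
  shows "a = b"
proof (rule poly_mapping_eqI)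
  show "Poly_Mapping.lookup a v = Poly_Mapping.lookup b v" for v using assms by (cases v) auto
qed

lemma yz_part_x_exp [simp]: "yz_part (x_exp n m) = m"
  by (rule exp_yz_eqI) simp_all

lemma yz_part_add_single:
  "yz_part (w + Poly_Mapping.single X n) = yz_part w"
  "yz_part (w + Poly_Mapping.single Y n) = Poly_Mapping.single Y' n + yz_part w"
  "yz_part (w + Poly_Mapping.single Z n) = Poly_Mapping.single Z' n + yz_part w"
  by (rule exp_yz_eqI; simp add: lookup_add lookup_single)+

lemma x_exp_divides_iff: "x_exp n e \<preceq> w \<longleftrightarrow> n \<le> Poly_Mapping.lookup w X \<and> e \<preceq> yz_part w"
  by (simp add: divides_exp_def all_var_xyz all_var_yz)

lemma embed_yz_mon: "embed_yz (mon m) = (mon (embed_exp m) :: (var_xyz, 'a::comm_ring_1) mpoly)"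
  by (simp add: embed_yz_def)

lemma x_power_embed_mon:
  "var X ^ n * embed_yz (mon m) = (mon (x_exp n m) :: (var_xyz, 'a::comm_ring_1) mpoly)"
  by (simp add: var_power embed_yz_mon mon_mult_mon x_exp_def)

lemma x_pow_ideal_mon:
  "x_pow_ideal n (ideal_gen (mon ` E))
     = (ideal_gen (mon ` x_exp n ` minimal_exps E) :: (var_xyz, 'a::comm_ring_1) mpoly set)"
  by (simp add: x_pow_ideal_def min_mono_gens_mon image_image x_power_embed_mon)

lemma minimal_exps_x_exp:
  "minimal_exps (x_exp n ` minimal_exps E) = x_exp n ` minimal_exps E"
  by (auto simp: minimal_exps_def x_exp_divides_iff)

lemma upset_x_exp_iff:
  "w \<in> upset (\<Union>j\<in>T. x_exp (i j) ` G j)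
     \<longleftrightarrow> (\<exists>j\<in>T. i j \<le> Poly_Mapping.lookup w X \<and> yz_part w \<in> upset (G j))"
  by (auto simp: upset_def x_exp_divides_iff)

text \<open>The set \<open>G j\<close> holds the generators that are new at stage \<open>j\<close>, that is, from \<open>x\<close>-exponent \<open>i j\<close> on.
  If \<open>w\<close> enters the ideal at stage \<open>j\<close> when it is multiplied by powers of \<open>x\<close>, then its part \<open>t\<close> in
  \<open>y, z\<close> is \<open>e s\<close> with \<open>e\<close> in \<open>G j\<close> and \<open>s\<close> outside a principal colon ideal. So \<open>s\<close> stays outside it
  along the powers of \<open>y\<close> or along those of \<open>z\<close>, which leave the \<open>x\<close>-exponent of \<open>w\<close> below \<open>i j\<close>.\<close>

lemma ray_outside:
  fixes G :: "nat \<Rightarrow> (var_yz \<Rightarrow>\<^sub>0 nat) set"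
  assumes i: "i 0 = 0" "strict_mono_on {0..p} i"
    and principal: "\<And>j e. 0 < j \<Longrightarrow> j \<le> p \<Longrightarrow> e \<in> G j \<Longrightarrow>
      is_principal (colon (ideal_gen (mon ` (\<Union>l<j. G l))) (mon e :: (var_yz, 'a::idom) mpoly))"
    and w: "w \<notin> upset (\<Union>j\<in>{0..p}. x_exp (i j) ` G j)"
  shows "\<exists>v. \<forall>n. w + Poly_Mapping.single v n \<notin> upset (\<Union>j\<in>{0..p}. x_exp (i j) ` G j)"
proof (cases "\<forall>n. w + Poly_Mapping.single X n \<notin> upset (\<Union>j\<in>{0..p}. x_exp (i j) ` G j)")
  case False
  define t where "t = yz_part w"
  have "\<exists>j. j \<le> p \<and> t \<in> upset (G j)"
    using False by (auto simp: upset_x_exp_iff yz_part_add_single t_def)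
  define j where "j = (LEAST j. j \<le> p \<and> t \<in> upset (G j))"
  have j: "j \<le> p" "t \<in> upset (G j)"
    unfolding j_def using LeastI_ex[OF \<open>\<exists>j. j \<le> p \<and> t \<in> upset (G j)\<close>] by auto
  have "t \<notin> upset (G l)" if "l < j" for l
    using not_less_Least[of l "\<lambda>j. j \<le> p \<and> t \<in> upset (G j)"] that j(1)
    unfolding j_def[symmetric] by auto
  then have below: "t \<notin> upset (\<Union>l<j. G l)" unfolding upset_UN by auto
  have ij: "Poly_Mapping.lookup w X < i j"
    using w j unfolding upset_x_exp_iff t_def by (auto simp: not_le[symmetric])
  then have "0 < j" using i(1) by (cases "j = 0") auto
  obtain e where e: "e \<in> G j" "e \<preceq> t" using j(2) by (auto simp: upset_def)
  let ?L = "ideal_gen (mon ` (\<Union>l<j. G l)) :: (var_yz, 'a) mpoly set"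
  have in_colon: "mon (m + (t - e)) \<in> colon ?L (mon e) \<longleftrightarrow> m + t \<in> upset (\<Union>l<j. G l)" for m
  proof -
    have "m + (t - e) + e = m + (e + (t - e))" by (simp only: ac_simps)
    also have "\<dots> = m + t" unfolding divides_exp_diff[OF e(2)] ..
    finally have "mon (m + (t - e)) * mon e = (mon (m + t) :: (var_yz, 'a) mpoly)"
      by (simp only: mon_mult_mon)
    then show ?thesis by (simp add: colon_def)
  qed
  have "\<not> (Poly_Mapping.single Y' a + t \<in> upset (\<Union>l<j. G l)
      \<and> Poly_Mapping.single Z' b + t \<in> upset (\<Union>l<j. G l))" for a b
    using principal_ideal_saturated[OF principal[OF \<open>0 < j\<close> j(1) e(1)], of Y' Z' a "t - e" b]
      in_colon[of 0] below by (auto simp: in_colon)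
  then consider (y) "\<forall>n. Poly_Mapping.single Y' n + t \<notin> upset (\<Union>l<j. G l)"
    | (z) "\<forall>n. Poly_Mapping.single Z' n + t \<notin> upset (\<Union>l<j. G l)"
    by blast
  then obtain v v' where "v \<noteq> X"
    and v: "\<forall>n. Poly_Mapping.single v' n + t \<notin> upset (\<Union>l<j. G l)"
    and yz: "\<And>n. yz_part (w + Poly_Mapping.single v n) = Poly_Mapping.single v' n + t"
  proof cases
    case y then show ?thesis by (intro that[of Y Y']) (simp_all add: yz_part_add_single t_def)
  next
    case z then show ?thesis by (intro that[of Z Z']) (simp_all add: yz_part_add_single t_def)
  qed
  have "w + Poly_Mapping.single v n \<notin> upset (\<Union>j\<in>{0..p}. x_exp (i j) ` G j)" for n
  proof
    assume "w + Poly_Mapping.single v n \<in> upset (\<Union>j\<in>{0..p}. x_exp (i j) ` G j)"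
    then obtain l where l: "l \<le> p" "i l \<le> Poly_Mapping.lookup w X"
      "Poly_Mapping.single v' n + t \<in> upset (G l)"
      using \<open>v \<noteq> X\<close> by (auto simp: upset_x_exp_iff yz lookup_add lookup_single)
    then have "l < j" using ij i(2) j(1) strict_mono_on_less[OF i(2), of l j] by simp
    then show False using v l(3) unfolding upset_UN by blast
  qed
  then show ?thesis by blast
qed blast

text \<open>Among the elements with least \<open>y\<close>-exponent let \<open>a\<close> have the least \<open>z\<close>-exponent. As \<open>a\<close> does not
  divide all of \<open>S\<close>, some element has a smaller \<open>z\<close>-exponent than \<open>a\<close>; let \<open>b\<close> be such an element with
  least \<open>y\<close>-exponent. Then \<open>b\<close> marks the place where the staircase first drops below \<open>a\<close>, and \<open>h\<close> is
  \<open>lcm(a, b) / (y z)\<close>.\<close>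

lemma corner_outside:
  fixes S :: "(var_yz \<Rightarrow>\<^sub>0 nat) set"
  assumes "S \<noteq> {}" and no_least: "\<And>e. e \<in> S \<Longrightarrow> \<exists>s\<in>S. \<not> e \<preceq> s"
  shows "\<exists>h. h \<notin> upset S \<and> (\<forall>v. Poly_Mapping.single v 1 + h \<in> upset S)"
proof -
  let ?y = "\<lambda>s. Poly_Mapping.lookup s Y'" and ?z = "\<lambda>s. Poly_Mapping.lookup s Z'"
  obtain a\<^sub>0 where a\<^sub>0: "a\<^sub>0 \<in> S" "\<And>s. s \<in> S \<Longrightarrow> ?y a\<^sub>0 \<le> ?y s"
    using ex_has_least_nat[of "\<lambda>s. s \<in> S" _ ?y] assms(1) by blast
  obtain a where a: "a \<in> S" "?y a = ?y a\<^sub>0" "\<And>s. s \<in> S \<Longrightarrow> ?y s = ?y a\<^sub>0 \<Longrightarrow> ?z a \<le> ?z s"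
    using ex_has_least_nat[of "\<lambda>s. s \<in> S \<and> ?y s = ?y a\<^sub>0" a\<^sub>0 ?z] a\<^sub>0(1) by blast
  obtain b\<^sub>0 where "b\<^sub>0 \<in> S" "\<not> a \<preceq> b\<^sub>0" using no_least[OF a(1)] by blast
  then have "?z b\<^sub>0 < ?z a" using a\<^sub>0(2) a(2) by (auto simp: divides_exp_def all_var_yz)
  then obtain b where b: "b \<in> S" "?z b < ?z a" "\<And>s. s \<in> S \<Longrightarrow> ?z s < ?z a \<Longrightarrow> ?y b \<le> ?y s"
    using ex_has_least_nat[of "\<lambda>s. s \<in> S \<and> ?z s < ?z a" b\<^sub>0 ?y] \<open>b\<^sub>0 \<in> S\<close> by blast
  have "?y a < ?y b" using a\<^sub>0(2)[OF b(1)] a b(1,2) by (metis le_neq_implies_less not_le)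
  define h where "h = Poly_Mapping.single Y' (?y b - 1) + Poly_Mapping.single Z' (?z a - 1)"
  have h: "?y h = ?y b - 1" "?z h = ?z a - 1"
    by (simp_all add: h_def lookup_add lookup_single)
  have "h \<notin> upset S"
  proof
    assume "h \<in> upset S"
    then obtain s where "s \<in> S" "s \<preceq> h" by (auto simp: upset_def)
    then have s: "s \<in> S" "?y s \<le> ?y b - 1" "?z s \<le> ?z a - 1"
      by (simp_all add: divides_exp_def all_var_yz h)
    then have "?y b \<le> ?y s" using b(2,3) by simp
    then show False using s(2) \<open>?y a < ?y b\<close> by simp
  qed
  moreover have "b \<preceq> Poly_Mapping.single Y' 1 + h" "a \<preceq> Poly_Mapping.single Z' 1 + h"
    using b(2) \<open>?y a < ?y b\<close> by (auto simp: divides_exp_def all_var_yz h lookup_add lookup_single)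
  then have "\<forall>v. Poly_Mapping.single v 1 + h \<in> upset S"
    unfolding all_var_yz upset_def using a(1) b(1) by blast
  ultimately show ?thesis by blast
qed

section \<open>The depth of \<open>R/I\<close>\<close>

theorem corollary3p19:
  fixes p :: nat
    and i :: "nat \<Rightarrow> nat"
    and u :: "nat \<Rightarrow> (var_yz, 'k::field) mpoly"
    and J :: "nat \<Rightarrow> (var_yz, 'k) mpoly set"
    and I :: "(var_xyz, 'k) mpoly set"
  assumes "p \<ge> 1"
    and "i 0 = 0" and "strict_mono_on {0..p} i"
    and "\<forall>j<p. is_monomial (u j)"
    and "\<forall>j<p. J j = ideal_gen {u j}"
    and "is_monomial_ideal (J p)" and "J p \<noteq> UNIV" and "J p \<noteq> {0}"
    and "\<exists>q\<le>p - 1.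
           (\<forall>j<q. u (Suc j) dvd u j \<and> u (Suc j) \<noteq> u j) \<and>
           (\<forall>j\<in>{q..p - 1}. u j \<notin> J p) \<and>
           (q + 2 \<le> p \<longrightarrow>
             (\<forall>j k. q \<le> j \<and> j < k \<and> k \<le> p - 1 \<longrightarrow> \<not> u j dvd u k) \<and>
             (\<forall>j\<in>{q + 1..p - 1}. is_principal (colon (ideal_gen (u ` {q..j - 1})) (u j))) \<and>
             (\<forall>v\<in>min_mono_gens (J p). is_principal (colon (ideal_gen (u ` {q..p - 1})) v)))"
    and "I = x_pow_ideal (i p) (J p) + ideal_gen ((\<lambda>j. var X ^ i j * embed_yz (u j)) ` {0..p - 1})"
    and "min_mono_gens I = (\<Union>j\<in>{0..p}. min_mono_gens (x_pow_ideal (i j) (J j)))"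
  shows "depth_quot max_graded_ideal I = 1"
proof -
  obtain q where q: "q \<le> p - 1" and chain: "\<forall>j<q. u (Suc j) dvd u j \<and> u (Suc j) \<noteq> u j"
    and not_in_Jp: "\<forall>j\<in>{q..p - 1}. u j \<notin> J p"
    and colons: "q + 2 \<le> p \<Longrightarrow>
      (\<forall>j\<in>{q + 1..p - 1}. is_principal (colon (ideal_gen (u ` {q..j - 1})) (u j))) \<and>
      (\<forall>v\<in>min_mono_gens (J p). is_principal (colon (ideal_gen (u ` {q..p - 1})) v))"
    using assms(9) by blast
  obtain d where d: "u j = mon (d j)" if "j < p" for j
    using assms(4) unfolding is_monomial_def by metis
  obtain E where Jp: "J p = ideal_gen (mon ` E)"
    using assms(6) monomials_eq_image unfolding is_monomial_ideal_def by metis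
  define M where "M = minimal_exps E"
  have gens_Jp: "min_mono_gens (J p) = mon ` M"
    by (simp add: Jp min_mono_gens_mon M_def)
  have "E \<noteq> {}" using assms(8) by (auto simp: Jp ideal_gen_empty)
  then obtain v where v: "v \<in> M" using exists_minimal_divisor unfolding M_def by blast
  \<comment> \<open>The generators that are new at stage \<open>j\<close>, so that \<open>L\<^sub>j\<close> is generated by \<open>\<Union>l\<le>j. G l\<close>.\<close>
  define G where "G j = (if j < p then {d j} else M)" for j
  define A where "A = (\<Union>j\<in>{0..p}. x_exp (i j) ` G j)"
  have G_below: "(\<Union>l<j. G l) = d ` {..<j}" if "j \<le> p" for j
    using that by (auto simp: G_def)
  have "{0..p} = insert p {0..p - 1}" using assms(1) by auto
  moreover have "(\<Union>j\<in>{0..p - 1}. x_exp (i j) ` G j) = (\<Union>j\<in>{0..p - 1}. {x_exp (i j) (d j)})"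
    using assms(1) by (intro SUP_cong) (auto simp: G_def)
  ultimately have A: "A = x_exp (i p) ` M \<union> (\<lambda>j. x_exp (i j) (d j)) ` {0..p - 1}"
    unfolding A_def by (simp add: G_def UNION_singleton_eq_range)
  have "(\<lambda>j. var X ^ i j * embed_yz (u j)) ` {0..p - 1} = mon ` (\<lambda>j. x_exp (i j) (d j)) ` {0..p - 1}"
    unfolding image_image using assms(1) by (intro image_cong) (auto simp: d x_power_embed_mon)
  then have I: "I = ideal_gen (mon ` A)"
    unfolding assms(10) A Jp x_pow_ideal_mon image_Un ideal_gen_Un M_def by simp
  \<comment> \<open>The assumption on \<open>\<G>(I)\<close> enters through the generators of \<open>x\<^sup>n I\<^sub>p\<close> with \<open>n = i\<^sub>p\<close>: they are minimal in
    \<open>I\<close>, so none is divisible by one of the generators that come from \<open>u\<^sub>j\<close> with \<open>j < p\<close>.\<close>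
  have "mon ` x_exp (i p) ` M = min_mono_gens (x_pow_ideal (i p) (J p))"
    by (simp add: Jp x_pow_ideal_mon min_mono_gens_mon M_def minimal_exps_x_exp)
  also have "\<dots> \<subseteq> min_mono_gens I" unfolding assms(11) by auto
  also have "\<dots> = mon ` minimal_exps A" unfolding I by (rule min_mono_gens_mon)
  finally have min_gen: "x_exp (i p) w \<in> minimal_exps A" if "w \<in> M" for w
    using that by (auto simp: image_subset_iff)
  have d_not_divides: "\<not> d j \<preceq> w" if "j < p" "w \<in> M" for j w
  proof
    assume "d j \<preceq> w"
    moreover have less: "i j < i p" using assms(3) that(1) by (auto simp: strict_mono_on_def)
    ultimately have "x_exp (i j) (d j) \<preceq> x_exp (i p) w" by (simp add: x_exp_divides_iff)
    moreover have "x_exp (i j) (d j) \<in> A" using that(1) unfolding A by auto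
    ultimately have "x_exp (i j) (d j) = x_exp (i p) w"
      using min_gen[OF that(2)] unfolding minimal_exps_def by blast
    then have "i j = i p" using lookup_x_exp(1) by metis
    then show False using less by simp
  qed
  have not_divides_d: "\<not> w \<preceq> d (p - 1)" if "w \<in> M" for w
  proof -
    have "d (p - 1) \<notin> upset E"
      using not_in_Jp[rule_format, of "p - 1"] q assms(1) by (simp add: Jp d)
    then show ?thesis using that by (auto simp: upset_def M_def minimal_exps_def)
  qed

  have principal: "is_principal (colon (ideal_gen (mon ` (\<Union>l<j. G l))) (mon e :: (var_yz, 'k) mpoly))"
    if j: "0 < j" "j \<le> p" and e: "e \<in> G j" for j e
  proof -
    have chain_d: "d (Suc l) \<preceq> d l" if "l < q" for l
    proof -
      have "u (Suc l) dvd u l" using chain that by blast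
      then show ?thesis using that q by (simp add: d mon_dvd_iff)
    qed
    \<comment> \<open>Up to stage \<open>q\<close> the \<open>u\<^sub>l\<close> form a divisor chain, so of these only the last one counts.\<close>
    show ?thesis
    proof (cases "j \<le> q + 1")
      case True
      have least: "d (j - 1) \<preceq> d l" if "l < j" for l
        by (rule divides_exp_chain[of q d, OF chain_d]) (use that True j in auto)
      have "upset (d ` {..<j}) = upset {d (j - 1)}"
        using j(1) least by (intro upset_eqI) auto
      then have "ideal_gen (mon ` (\<Union>l<j. G l)) = (ideal_gen (mon ` {d (j - 1)}) :: (var_yz, 'k) mpoly set)"
        unfolding ideal_gen_mon_eq_iff G_below[OF j(2)] .
      then show ?thesis by (simp add: is_principal_colon_mon)
    next
      case False
      have least: "d q \<preceq> d l" if "l < q" for l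
        by (rule divides_exp_chain[of q d, OF chain_d]) (use that in auto)
      have "\<exists>a\<in>d ` {q..j - 1}. a \<preceq> d l" if "l < j" for l
      proof (cases "l < q")
        case True
        then show ?thesis using least False by (intro bexI[of _ "d q"]) auto
      next
        case False
        then show ?thesis using that by (intro bexI[of _ "d l"]) auto
      qed
      then have "upset (d ` {..<j}) = upset (d ` {q..j - 1})"
        using j(1) by (intro upset_eqI) auto
      then have "ideal_gen (mon ` (\<Union>l<j. G l)) = (ideal_gen (mon ` d ` {q..j - 1}) :: (var_yz, 'k) mpoly set)"
        unfolding ideal_gen_mon_eq_iff G_below[OF j(2)] .
      also have "mon ` d ` {q..j - 1} = u ` {q..j - 1}"
        unfolding image_image using j by (intro image_cong) (auto simp: d)
      finally have eq: "ideal_gen (mon ` (\<Union>l<j. G l)) = ideal_gen (u ` {q..j - 1})" .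
      show ?thesis
      proof (cases "j < p")
        case True
        then have "mon e = u j" using e by (simp add: G_def d)
        then show ?thesis unfolding eq using colons True False by auto
      next
        case not_less: False
        then have "j = p" using j by simp
        then have "mon e \<in> min_mono_gens (J p)" using e by (auto simp: G_def gens_Jp)
        then show ?thesis unfolding eq using colons False \<open>j = p\<close> by auto
      qed
    qed
  qed

  let ?f = "\<Sum>v\<in>UNIV. var v :: (var_xyz, 'k) mpoly"
  show ?thesis
  proof (rule depth_quot_eq_1I)
    show f_max: "?f \<in> max_graded_ideal"
      unfolding max_graded_ideal_def ideal_gen_def
      by (intro module.span_sum[OF module_times] module.span_base[OF module_times]) auto
    have nzd: "g \<in> I" if "?f * g \<in> I" for g
      using sum_of_vars_nonzerodivisor[of A g] that
        ray_outside[OF assms(2,3) principal] unfolding I A_def by blast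
    \<comment> \<open>A generator 1 of \<open>I\<close> could only be \<open>u\<^sub>0\<close>, which would then divide the generators of \<open>I\<^sub>p\<close>.\<close>
    have "0 \<notin> upset A"
    proof
      assume "0 \<in> upset A"
      then have "0 \<in> A" by (auto simp: upset_def divides_exp_zero_iff)
      then obtain j e where je: "j \<le> p" "e \<in> G j" "x_exp (i j) e = 0" by (auto simp: A_def)
      have "i j = 0" using lookup_x_exp(1)[of "i j" e] by (simp add: je(3))
      have "e = 0"
        using lookup_x_exp(2,3)[of "i j" e] by (intro exp_yz_eqI) (simp_all add: je(3))
      have "j = 0" using strict_mono_on_less[OF assms(3), of 0 j] assms(2) je(1) \<open>i j = 0\<close> by auto
      then have "d 0 = 0" using je(2) \<open>e = 0\<close> assms(1) by (simp add: G_def)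
      then show False using d_not_divides[of 0 v] v assms(1) by simp
    qed
    then have "I \<subseteq> max_graded_ideal" by (auto simp: I ideal_gen_mon max_graded_ideal_eq)
    moreover have "ideal_gen {?f} \<subseteq> max_graded_ideal"
      using f_max unfolding ideal_gen_singleton max_graded_ideal_def by (auto intro: ideal_gen_mult)
    ultimately have "I + ideal_gen {?f} \<subseteq> max_graded_ideal"
      unfolding max_graded_ideal_def by (auto simp: set_plus_def intro!: ideal_gen_add)
    moreover have "1 \<notin> (max_graded_ideal :: (var_xyz, 'k) mpoly set)"
      by (simp add: max_graded_ideal_eq)
    ultimately have "I + ideal_gen {?f} \<noteq> UNIV" by auto
    moreover have "I + {0} = I" by (simp add: set_plus_def)
    ultimately show "regular_on_quot I [?f]"
      using nzd by (simp add: regular_on_quot_def ideal_gen_empty)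
  next
    fix f\<^sub>1 f\<^sub>2 :: "(var_xyz, 'k) mpoly"
    assume f: "f\<^sub>1 \<in> max_graded_ideal" "f\<^sub>2 \<in> max_graded_ideal"
      and reg: "\<forall>g. f\<^sub>1 * g \<in> I \<longrightarrow> g \<in> I"
        "\<forall>g. f\<^sub>2 * g \<in> I + ideal_gen {f\<^sub>1} \<longrightarrow> g \<in> I + ideal_gen {f\<^sub>1}"
    let ?S = "\<Union>j\<in>{0..p}. G j"
    \<comment> \<open>The ideal \<open>L\<^sub>p\<close> is not principal.\<close>
    have "\<exists>s\<in>?S. \<not> e \<preceq> s" if e: "e \<in> ?S" for e
    proof -
      obtain j where j: "j \<le> p" "e \<in> G j" using e by auto
      show ?thesis
      proof (cases "j < p")
        case True
        then have "\<not> e \<preceq> v" using j(2) d_not_divides v by (simp add: G_def)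
        moreover have "v \<in> ?S" using v by (auto simp: G_def intro!: bexI[of _ p])
        ultimately show ?thesis by blast
      next
        case False
        then have "\<not> e \<preceq> d (p - 1)" using j(2) not_divides_d by (simp add: G_def)
        moreover have "d (p - 1) \<in> ?S"
          using assms(1) by (auto simp: G_def intro!: bexI[of _ "p - 1"])
        ultimately show ?thesis by blast
      qed
    qed
    moreover have "?S \<noteq> {}" using v by (auto simp: G_def intro!: bexI[of _ p])
    ultimately obtain h where h: "h \<notin> upset ?S" "\<forall>v. Poly_Mapping.single v 1 + h \<in> upset ?S"
      using corner_outside[of ?S] by blast
    \<comment> \<open>From \<open>x\<close>-exponent \<open>i\<^sub>p\<close> on, membership in \<open>I\<close> is membership in \<open>L\<^sub>p\<close>.\<close>
    have "x_exp (i p) h \<notin> upset A"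
      using h(1) unfolding A_def upset_x_exp_iff unfolding upset_UN by auto
    moreover have "Poly_Mapping.single v 1 + x_exp (i p) h \<in> upset A" if "v \<noteq> X" for v
    proof -
      have "\<exists>v'. yz_part (x_exp (i p) h + Poly_Mapping.single v 1) = Poly_Mapping.single v' 1 + h"
        using that yz_part_add_single[of "x_exp (i p) h" 1] by (cases v) auto
      then have "yz_part (x_exp (i p) h + Poly_Mapping.single v 1) \<in> upset ?S" using h(2) by auto
      then obtain j where j: "j \<le> p" "yz_part (x_exp (i p) h + Poly_Mapping.single v 1) \<in> upset (G j)"
        unfolding upset_UN by auto
      have "i j \<le> Poly_Mapping.lookup (x_exp (i p) h + Poly_Mapping.single v 1) X"
        using strict_mono_on_leD[OF assms(3), of j p] j(1) by (simp add: lookup_add)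
      then show ?thesis
        unfolding A_def upset_x_exp_iff add.commute[of "Poly_Mapping.single v 1"]
        using j by (intro bexI[of _ j]) auto
    qed
    ultimately show False
      using no_regular_pair[OF _ _ f I] reg by blast
  qed
qed

end
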